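(* Let $K$ be a field, $R=K[x_0,\dots,x_n]$, $I\subseteq R$ an ideal, and $s\ge1$ an integer. If $I$ is primary to the ideal $(x_s,\dots,x_n)$ and $\widetilde I\cap\big(I:(x_s,\dots,x_n)\big)\subseteq I$, then $I$ is Ratliff-Rush closed.
   Context: Ratliff-Rush closure: for an ideal $I$ of a commutative Noetherian ring $R$ containing a nonzerodivisor, $\widetilde I=\bigcup_{k\ge1}(I^{k+1}:I^k)$, where $I^{k+1}:I^k=\{x\in R: xI^k\subseteq I^{k+1}\}$; $I$ is Ratliff-Rush closed if $\widetilde I=I$. (An ideal primary to $(x_s,\dots,x_n)$ contains a power of $x_n$, hence a nonzerodivisor.) *)

theory Defs
  imports "HOL-Library.Poly_Mapping"
begin

text \<open>Polynomials over a field 'k in variables indexed by nat: monomials are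
  finitely supported exponent vectors (nat =>0 nat). The ring K[x_0,...,x_n]
  is the carrier of polynomials only involving variables 0..n.\<close>

type_synonym 'k mpoly = "(nat \<Rightarrow>\<^sub>0 nat) \<Rightarrow>\<^sub>0 'k"

definition polyring :: "nat \<Rightarrow> 'k::field mpoly set" where
  "polyring n = {p. \<forall>m \<in> Poly_Mapping.keys p. Poly_Mapping.keys m \<subseteq> {..n}}"

definition var :: "nat \<Rightarrow> 'k::field mpoly" where
  "var i = Poly_Mapping.single (Poly_Mapping.single i 1) 1"

definition is_ideal :: "'a::comm_ring_1 set \<Rightarrow> 'a set \<Rightarrow> bool" where
  "is_ideal S I \<longleftrightarrow> I \<subseteq> S \<and> 0 \<in> I \<and> (\<forall>a\<in>I. \<forall>b\<in>I. a + b \<in> I)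
     \<and> (\<forall>r\<in>S. \<forall>a\<in>I. r * a \<in> I)"

definition ideal_gen :: "'a::comm_ring_1 set \<Rightarrow> 'a set \<Rightarrow> 'a set" where
  "ideal_gen S G = \<Inter>{J. is_ideal S J \<and> G \<subseteq> J}"

definition ideal_prod :: "'a::comm_ring_1 set \<Rightarrow> 'a set \<Rightarrow> 'a set \<Rightarrow> 'a set" where
  "ideal_prod S I J = ideal_gen S {a * b | a b. a \<in> I \<and> b \<in> J}"

primrec ideal_pow :: "'a::comm_ring_1 set \<Rightarrow> 'a set \<Rightarrow> nat \<Rightarrow> 'a set" where
  "ideal_pow S I 0 = S"
| "ideal_pow S I (Suc k) = ideal_prod S I (ideal_pow S I k)"

definition ideal_colon :: "'a::comm_ring_1 set \<Rightarrow> 'a set \<Rightarrow> 'a set \<Rightarrow> 'a set" where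
  "ideal_colon S I J = {x \<in> S. \<forall>y\<in>J. x * y \<in> I}"

definition ideal_radical :: "'a::comm_ring_1 set \<Rightarrow> 'a set \<Rightarrow> 'a set" where
  "ideal_radical S I = {x \<in> S. \<exists>m. x ^ m \<in> I}"

definition primary_ideal :: "'a::comm_ring_1 set \<Rightarrow> 'a set \<Rightarrow> bool" where
  "primary_ideal S I \<longleftrightarrow> is_ideal S I \<and> I \<noteq> S \<and>
     (\<forall>a\<in>S. \<forall>b\<in>S. a * b \<in> I \<longrightarrow> a \<in> I \<or> b \<in> ideal_radical S I)"

definition primary_to :: "'a::comm_ring_1 set \<Rightarrow> 'a set \<Rightarrow> 'a set \<Rightarrow> bool" where
  "primary_to S I P \<longleftrightarrow> primary_ideal S I \<and> ideal_radical S I = P"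

definition ratliff_rush :: "'a::comm_ring_1 set \<Rightarrow> 'a set \<Rightarrow> 'a set" where
  "ratliff_rush S I = (\<Union>k\<in>{1..}. ideal_colon S (ideal_pow S I (Suc k)) (ideal_pow S I k))"

definition ratliff_rush_closed :: "'a::comm_ring_1 set \<Rightarrow> 'a set \<Rightarrow> bool" where
  "ratliff_rush_closed S I \<longleftrightarrow> ratliff_rush S I = I"

end

theory Submission
  imports Defs
begin

text \<open>If $f \in \widetilde I \setminus I$, multiply $f$ by powers of $x_s, \dots, x_n$, one variable
  after the other, each time with the largest exponent that keeps the product outside $I$; these
  exponents exist because some power of every $x_i$ lies in $I$. The resulting multiple of $f$ lies
  in $\widetilde I \cap (I : (x_s, \dots, x_n))$ but not in $I$.\<close>

text \<open>With both arguments equal, \<open>is_ideal\<close> says that the carrier contains 0 and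
  is closed under sums and products. In this form it serves, together with \<open>1 \<in> S\<close>,
  as the ring hypothesis of the lemmas below.\<close>

lemma is_ideal_polyring: "is_ideal (polyring n) (polyring n)"
proof -
  have "a + b \<in> polyring n" if "a \<in> polyring n" "b \<in> polyring n" for a b :: "'k::field mpoly"
    using that Poly_Mapping.keys_add[of a b] unfolding polyring_def by blast
  moreover have "a * b \<in> polyring n"
    if "a \<in> polyring n" "b \<in> polyring n" for a b :: "'k::field mpoly"
  proof -
    have "Poly_Mapping.keys m \<subseteq> {..n}" if m: "m \<in> Poly_Mapping.keys (a * b)" for m
    proof -
      obtain u v where "m = u + v" "u \<in> Poly_Mapping.keys a" "v \<in> Poly_Mapping.keys b"
        using keys_mult[of a b] m by blast
      then show ?thesis
        using \<open>a \<in> _\<close> \<open>b \<in> _\<close> Poly_Mapping.keys_add[of u v] unfolding polyring_def by blast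
    qed
    then show ?thesis unfolding polyring_def by blast
  qed
  moreover have "0 \<in> polyring n"
    by (simp add: polyring_def)
  ultimately show ?thesis unfolding is_ideal_def by blast
qed

lemma one_in_polyring: "1 \<in> polyring n"
  by (simp add: polyring_def)

lemma ideal_gen_superset: "G \<subseteq> ideal_gen S G"
  unfolding ideal_gen_def by blast

lemma ideal_gen_least: "is_ideal S J \<Longrightarrow> G \<subseteq> J \<Longrightarrow> ideal_gen S G \<subseteq> J"
  unfolding ideal_gen_def by blast

lemma is_ideal_ideal_gen:
  assumes "is_ideal S S" "G \<subseteq> S"
  shows "is_ideal S (ideal_gen S G)"
proof -
  have mem: "x \<in> ideal_gen S G \<longleftrightarrow> (\<forall>J. is_ideal S J \<longrightarrow> G \<subseteq> J \<longrightarrow> x \<in> J)" for x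
    unfolding ideal_gen_def by blast
  have "0 \<in> ideal_gen S G"
    unfolding mem by (simp add: is_ideal_def)
  moreover have "a + b \<in> ideal_gen S G" if "a \<in> ideal_gen S G" "b \<in> ideal_gen S G" for a b
    using that unfolding mem by (simp add: is_ideal_def)
  moreover have "r * a \<in> ideal_gen S G" if "r \<in> S" "a \<in> ideal_gen S G" for r a
    using that unfolding mem by (simp add: is_ideal_def)
  \<comment> \<open>\<open>S\<close> is itself one of the ideals being intersected, which bounds the
    intersection by \<open>S\<close>.\<close>
  ultimately show ?thesis
    using ideal_gen_least[OF assms] unfolding is_ideal_def[of S "ideal_gen S G"] by blast
qed

lemma is_ideal_ideal_pow:
  assumes "is_ideal S S" "is_ideal S I"
  shows "is_ideal S (ideal_pow S I k)"
proof (induction k)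
  case 0
  then show ?case using assms by simp
next
  case (Suc k)
  have "{a * b | a b. a \<in> I \<and> b \<in> ideal_pow S I k} \<subseteq> S"
  proof safe
    fix a b assume "a \<in> I" "b \<in> ideal_pow S I k"
    then have "a \<in> S" "b \<in> S"
      using Suc assms(2) unfolding is_ideal_def by (meson subsetD)+
    then show "a * b \<in> S"
      using assms(1) unfolding is_ideal_def by simp
  qed
  then show ?case
    using is_ideal_ideal_gen[OF assms(1)] by (simp add: ideal_prod_def)
qed

lemma is_ideal_vimage_mult:
  assumes "is_ideal S S" "is_ideal S I" "x \<in> S"
  shows "is_ideal S {y \<in> S. x * y \<in> I}"
proof -
  have "x * (r * a) \<in> I" if "r \<in> S" "x * a \<in> I" for r a
    using assms(2) that unfolding is_ideal_def by (simp add: mult.left_commute)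
  then show ?thesis
    using assms(1,2) unfolding is_ideal_def by (simp add: distrib_left)
qed

text \<open>For fixed \<open>x\<close> the elements \<open>y\<close> with
  \<open>x * y \<in> I\<close> form an ideal, so they contain \<open>ideal_gen S G\<close> as soon
  as they contain \<open>G\<close>. Hence membership in the colon can be tested on the variables
  alone.\<close>

lemma ideal_colon_ideal_gen:
  assumes "is_ideal S S" "is_ideal S I" "G \<subseteq> S"
  shows "ideal_colon S I (ideal_gen S G) = ideal_colon S I G"
proof -
  have "\<forall>y\<in>ideal_gen S G. x * y \<in> I" if "x \<in> S" "\<forall>y\<in>G. x * y \<in> I" for x
    using ideal_gen_least[OF is_ideal_vimage_mult[OF assms(1,2) \<open>x \<in> S\<close>], of G] that assms(3)
    by blast
  then show ?thesis
    using ideal_gen_superset[of G S] unfolding ideal_colon_def by blast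
qed

lemma subset_ratliff_rush:
  assumes "is_ideal S I"
  shows "I \<subseteq> ratliff_rush S I"
proof
  fix x assume "x \<in> I"
  \<comment> \<open>The first exponent of the union, 1, already works: \<open>x * y\<close> is one
    of the generators of the next power.\<close>
  then have "x * y \<in> ideal_pow S I (Suc 1)" if "y \<in> ideal_pow S I 1" for y
    using that ideal_gen_superset[of "{a * b | a b. a \<in> I \<and> b \<in> ideal_pow S I 1}" S]
    by (auto simp: ideal_prod_def)
  then have "x \<in> ideal_colon S (ideal_pow S I (Suc 1)) (ideal_pow S I 1)"
    using \<open>x \<in> I\<close> assms unfolding ideal_colon_def is_ideal_def by blast
  then show "x \<in> ratliff_rush S I"
    unfolding ratliff_rush_def by (intro UN_I[of 1]) auto
qed

text \<open>The exponent \<open>k\<close> that witnesses \<open>x\<close> also witnesses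
  \<open>r * x\<close>, because the power on the left of the colon is an ideal.\<close>

lemma ratliff_rush_mult:
  assumes "is_ideal S S" "is_ideal S I" "r \<in> S" "x \<in> ratliff_rush S I"
  shows "r * x \<in> ratliff_rush S I"
proof -
  obtain k where k: "k \<in> {1..}" "x \<in> S"
      "\<forall>y\<in>ideal_pow S I k. x * y \<in> ideal_pow S I (Suc k)"
    using assms(4) unfolding ratliff_rush_def ideal_colon_def by blast
  have "\<forall>y\<in>ideal_pow S I k. r * x * y \<in> ideal_pow S I (Suc k)"
    using k(3) assms(3) is_ideal_ideal_pow[OF assms(1,2), of "Suc k"]
    unfolding is_ideal_def mult.assoc by blast
  moreover have "r * x \<in> S"
    using assms(1,3) k(2) unfolding is_ideal_def by blast
  ultimately show ?thesis
    using k(1) unfolding ratliff_rush_def ideal_colon_def by blast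
qed

lemma exists_multiple_in_ideal_colon:
  assumes S: "is_ideal S S" "1 \<in> S" and I: "is_ideal S I"
    and "finite G" "G \<subseteq> ideal_radical S I" "f \<in> S" "f \<notin> I"
  shows "\<exists>r\<in>S. r * f \<notin> I \<and> r * f \<in> ideal_colon S I G"
  using assms(4,5)
proof (induction G)
  case empty
  \<comment> \<open>The colon by the empty set is all of \<open>S\<close>, so the multiplier 1
    suffices.\<close>
  show ?case using \<open>1 \<in> S\<close> assms(6,7) by (intro bexI[of _ 1]) (simp_all add: ideal_colon_def)
next
  case (insert g G)
  have mult_S: "a * b \<in> S" if "a \<in> S" "b \<in> S" for a b
    using S(1) that unfolding is_ideal_def by blast
  have mult_I: "a * b \<in> I" if "a \<in> S" "b \<in> I" for a b
    using I that unfolding is_ideal_def by blast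
  obtain r where r: "r \<in> S" "r * f \<notin> I" "\<forall>y\<in>G. r * f * y \<in> I"
    using insert unfolding ideal_colon_def by blast
  obtain m where "g \<in> S" "g ^ m \<in> I"
    using insert.prems unfolding ideal_radical_def by blast
  have pow_S: "g ^ k \<in> S" for k
    by (induction k) (use S(2) \<open>g \<in> S\<close> mult_S in auto)
  have "g ^ m * (r * f) \<in> I"
    using mult_I[of "r * f" "g ^ m"] mult_S[OF r(1) \<open>f \<in> S\<close>] \<open>g ^ m \<in> I\<close> by (simp add: mult.commute)
  \<comment> \<open>Membership fails at exponent 0, since \<open>r * f \<notin> I\<close>, and holds
    at \<open>m\<close>; \<open>k\<close> is the last exponent before it first holds.\<close>
  then obtain k where k: "g ^ k * (r * f) \<notin> I" "g ^ Suc k * (r * f) \<in> I"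
    using ex_least_nat_less[of "\<lambda>k. g ^ k * (r * f) \<in> I" m] r(2) by auto
  have "g ^ k * r * f * y \<in> I" if "y \<in> insert g G" for y
  proof (cases "y = g")
    case True
    then show ?thesis using k(2) by (simp add: mult_ac)
  next
    case False
    \<comment> \<open>The generators treated earlier stay harmless, since the extra factor
      \<open>g ^ k\<close> cannot lead out of \<open>I\<close>.\<close>
    then have "g ^ k * (r * f * y) \<in> I"
      using that r(3) mult_I pow_S by blast
    then show ?thesis by (simp add: mult_ac)
  qed
  moreover have "g ^ k * r * f \<notin> I"
    using k(1) by (simp add: mult_ac)
  ultimately show ?case
    using mult_S pow_S r(1) \<open>f \<in> S\<close>
    by (intro bexI[of _ "g ^ k * r"]) (auto simp: ideal_colon_def)
qed

lemma ratliff_rush_closedI: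
  assumes S: "is_ideal S S" "1 \<in> S" and I: "is_ideal S I"
    and G: "finite G" "G \<subseteq> ideal_radical S I"
    and socle: "ratliff_rush S I \<inter> ideal_colon S I (ideal_gen S G) \<subseteq> I"
  shows "ratliff_rush_closed S I"
proof -
  have "f \<in> I" if f: "f \<in> ratliff_rush S I" for f
  proof (rule ccontr)
    assume "f \<notin> I"
    moreover have "f \<in> S"
      using f unfolding ratliff_rush_def ideal_colon_def by blast
    ultimately obtain r where "r \<in> S" "r * f \<notin> I" "r * f \<in> ideal_colon S I G"
      using exists_multiple_in_ideal_colon[OF S I G] by blast
    moreover have "G \<subseteq> S"
      using G(2) unfolding ideal_radical_def by blast
    \<comment> \<open>The multiple \<open>r * f\<close> is still in the Ratliff-Rush closure and, by
      passing from \<open>G\<close> to the ideal it generates, in the colon of \<open>socle\<close>,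
      yet outside \<open>I\<close>.\<close>
    ultimately show False
      using socle ratliff_rush_mult[OF S(1) I _ f] ideal_colon_ideal_gen[OF S(1) I] by blast
  qed
  then show ?thesis
    using subset_ratliff_rush[OF I] unfolding ratliff_rush_closed_def by blast
qed

theorem mainTheorem2:
  fixes n s :: nat and I :: "'k::field mpoly set"
  assumes "1 \<le> s" and "s \<le> n"
    and "is_ideal (polyring n) I"
    and "primary_to (polyring n) I (ideal_gen (polyring n) {var i | i. s \<le> i \<and> i \<le> n})"
    and "ratliff_rush (polyring n) I
           \<inter> ideal_colon (polyring n) I (ideal_gen (polyring n) {var i | i. s \<le> i \<and> i \<le> n})
           \<subseteq> I"
  shows "ratliff_rush_closed (polyring n) I"
proof (rule ratliff_rush_closedI[OF is_ideal_polyring one_in_polyring assms(3) _ _ assms(5)])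
  show "finite {var i :: 'k mpoly | i. s \<le> i \<and> i \<le> n}"
    by simp
  \<comment> \<open>Primariness enters through the radical: it equals the ideal generated by these
    variables, so each has a power in \<open>I\<close>.\<close>
  show "{var i | i. s \<le> i \<and> i \<le> n} \<subseteq> ideal_radical (polyring n) I"
    using assms(4) ideal_gen_superset unfolding primary_to_def by simp
qed

end
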